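(* Fix $m,p\in\mathbb N$. Let $X,Y$ be separable Hilbert spaces, $D_G\subset X$ a closed admissible data set, and $G:D_G\to Y$ a continuous (physical inverse) map. Let $D_G^{\mathrm{Lip}}\subset D_G$ be the admissible data set generated by a finite-dimensional admissible class of unknowns, and assume that $G:D_G^{\mathrm{Lip}}\to Y$ satisfies the Lipschitz stability estimate $$\|G(f_1)-G(f_2)\|_Y\le C_{\mathrm{Lip}}\|f_1-f_2\|_X,\qquad f_1,f_2\in D_G^{\mathrm{Lip}}.$$ Let $\mu$ be a Borel probability measure on $X$ with $\mu(D_G)=1$, $\int_X\|f\|_X^2\,d\mu(f)<\infty$ and $\int_{D_G}\|G(f)\|_Y^2\,d\mu(f)<\infty$, and let $\mathcal E:X\to\mathbb R^m$ be Borel measurable. Let $\mathcal D:\mathbb R^m\to X$ and $\mathcal P:Y\to\mathbb R^p$ be Lipschitz continuous, and set $K:=\operatorname{supp}(\mathcal E_\#\mu)\subset\mathbb R^m$. Assume that $K$ is compact and that $\mathcal D(K)\subset D_G^{\mathrm{Lip}}$. Define $H:=\mathcal P\circ G\circ\mathcal D:K\to\mathbb R^p$. Then there exist constants $c_0',c_1',c_2',C>0$, which may depend on the prescribed ranks $m,p$ and on the fixed data in the assumptions but are independent of $\eta$ and $N$, such that: (i) for every $\eta\in(0,1)$ there exists a ReLU neural network $\mathcal A_\eta:\mathbb R^m\to\mathbb R^p$ with $$\|\mathcal A_\eta-H\|_{L^2(K,\mathcal E_\#\mu)}\le\eta$$ and $$\mathrm{size}(\mathcal A_\eta)\le c_0'(p+1)\eta^{-m}\bigl(1+\log(\eta^{-1})\bigr),\qquad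 \mathrm{depth}(\mathcal A_\eta)\le c_1'+c_2'm\log(\eta^{-1});$$ (ii) for all sufficiently large $N\in\mathbb N$, $$\mathscr E_{\mathcal A}(N)\le C\left(\frac{(p+1)\log N}{N}\right)^{1/m},$$ where $\mathscr E_{\mathcal A}(N)$ is the infimum of $\|\mathcal A-H\|_{L^2(K,\mathcal E_\#\mu)}$ over all ReLU networks $\mathcal A:\mathbb R^m\to\mathbb R^p$ with $\mathrm{size}(\mathcal A)\le N$.
   Context: "Generated by a finite-dimensional admissible class" means that $D_G^{\mathrm{Lip}}$ consists of the data in $D_G$ that arise from unknowns (elements of $Y$ to be recovered by $G$) restricted to a finite-dimensional admissible class. ReLU network: a map $\Phi=C_\Lambda\circ\sigma\circ C_{\Lambda-1}\circ\cdots\circ\sigma\circ C_1$ where $\Lambda\ge1$, $\sigma(x)=\max\{x,0\}$ acts componentwise, and $C_\ell(z)=W_\ell z+b_\ell$ are affine maps with $W_\ell\in\mathbb R^{d_{\ell+1}\times d_\ell}$, $b_\ell\in\mathbb R^{d_{\ell+1}}$. With $\|A\|_0$ the number of nonzero entries of a matrix or vector $A$, $\mathrm{size}(\Phi):=\sum_{\ell=1}^{\Lambda}(\|W_\ell\|_0+\|b_\ell\|_0)$ and $\mathrm{depth}(\Phi):=\Lambda-1$. $\mathcal E_\#\mu$ is the pushforward measure; $\mathbb R^m$ and $\mathbb R^p$ carry Euclidean norms. *)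

theory Defs
  imports "HOL-Probability.Probability"
begin

text \<open>
  A layer is an affine map \<open>z \<mapsto> W z + b\<close> from \<open>\<real>\<^sup>k\<close> to \<open>\<real>\<^sup>l\<close>. The widths of the hidden layers
  vary with the network, so vectors inside a network are functions on \<open>nat\<close>, of which
  only the coordinates below the respective dimension matter; entries of \<open>W\<close> and \<open>b\<close> outside the
  index range are ignored.
\<close>

datatype layer =
  Layer (dim_in: nat) (dim_out: nat) (weight: "nat \<Rightarrow> nat \<Rightarrow> real") (bias: "nat \<Rightarrow> real")

definition affine :: "layer \<Rightarrow> (nat \<Rightarrow> real) \<Rightarrow> nat \<Rightarrow> real" where
  "affine C z = (\<lambda>i. if i < dim_out C then (\<Sum>j<dim_in C. weight C i j * z j) + bias C i else 0)"

definition relu :: "(nat \<Rightarrow> real) \<Rightarrow> nat \<Rightarrow> real" where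
  "relu z = (\<lambda>i. max (z i) 0)"

text \<open>The list \<open>[C\<^sub>1, \<dots>, C\<^sub>n]\<close> stands for \<open>C\<^sub>n \<circ> relu \<circ> \<dots> \<circ> relu \<circ> C\<^sub>1\<close>: there is no activation after
  the last layer.\<close>

fun realization :: "layer list \<Rightarrow> (nat \<Rightarrow> real) \<Rightarrow> nat \<Rightarrow> real" where
  "realization [] z = z"
| "realization [C] z = affine C z"
| "realization (C # C' # \<Phi>) z = realization (C' # \<Phi>) (relu (affine C z))"

definition relu_network :: "nat \<Rightarrow> nat \<Rightarrow> layer list \<Rightarrow> bool" where
  "relu_network m p \<Phi> \<longleftrightarrow>
     \<Phi> \<noteq> [] \<and> dim_in (hd \<Phi>) = m \<and> dim_out (last \<Phi>) = p \<and>
     successively (\<lambda>C C'. dim_out C = dim_in C') \<Phi> \<and>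
     (\<forall>C\<in>set \<Phi>. 0 < dim_in C \<and> 0 < dim_out C)"

definition layer_size :: "layer \<Rightarrow> nat" where
  "layer_size C =
     card {(i, j). i < dim_out C \<and> j < dim_in C \<and> weight C i j \<noteq> 0} +
     card {i. i < dim_out C \<and> bias C i \<noteq> 0}"

definition network_size :: "layer list \<Rightarrow> nat" where
  "network_size \<Phi> = (\<Sum>C\<leftarrow>\<Phi>. layer_size C)"

definition network_depth :: "layer list \<Rightarrow> nat" where
  "network_depth \<Phi> = length \<Phi> - 1"

text \<open>
  Coordinates of \<open>real ^ 'n\<close> are numbered \<open>0, \<dots>, CARD('n) - 1\<close> by a fixed enumeration of the index
  type. Another enumeration only permutes the columns of the first and the rows of the last layer,
  so the choice affects neither the class of functions realized by networks nor size and depth.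
\<close>

definition coord_enum :: "nat \<Rightarrow> 'n::finite" where
  "coord_enum = (SOME e. bij_betw e {..<CARD('n)} UNIV)"

lemma bij_betw_coord_enum: "bij_betw (coord_enum :: nat \<Rightarrow> 'n::finite) {..<CARD('n)} UNIV"
proof -
  have "\<exists>e :: nat \<Rightarrow> 'n. bij_betw e {..<CARD('n)} UNIV"
    using ex_bij_betw_nat_finite[of "UNIV :: 'n set"] by (simp add: atLeast0LessThan)
  then show ?thesis
    unfolding coord_enum_def by (rule someI_ex)
qed

definition to_coords :: "real ^ 'n::finite \<Rightarrow> nat \<Rightarrow> real" where
  "to_coords x = (\<lambda>i. if i < CARD('n) then x $ coord_enum i else 0)"

definition of_coords :: "(nat \<Rightarrow> real) \<Rightarrow> real ^ 'n::finite" where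
  "of_coords z = (\<chi> k. z (the_inv_into {..<CARD('n)} coord_enum k))"

definition network_fun :: "layer list \<Rightarrow> real ^ 'm::finite \<Rightarrow> real ^ 'p::finite" where
  "network_fun \<Phi> x = of_coords (realization \<Phi> (to_coords x))"

definition measure_support :: "'a::topological_space measure \<Rightarrow> 'a set" where
  "measure_support M = {x. \<forall>U. open U \<longrightarrow> x \<in> U \<longrightarrow> emeasure M U > 0}"

text \<open>The extended-valued norm: it is infinite for functions outside \<open>L\<^sup>2(M)\<close>, where the real-valued
  Bochner integral of the squared norm would be \<open>0\<close> by convention.\<close>

definition L2_enorm :: "'a measure \<Rightarrow> ('a \<Rightarrow> 'b::real_normed_vector) \<Rightarrow> ennreal" where
  "L2_enorm M f =
     (if f \<in> borel_measurable M \<and> (\<integral>\<^sup>+ x. ennreal ((norm (f x))\<^sup>2) \<partial>M) < \<infinity>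
      then ennreal (sqrt (enn2real (\<integral>\<^sup>+ x. ennreal ((norm (f x))\<^sup>2) \<partial>M))) else \<infinity>)"

text \<open>The infimum is taken in \<open>ennreal\<close>, so it is not affected by conventions for infima of reals.\<close>

definition network_error :: "(real ^ 'm::finite) measure \<Rightarrow> (real ^ 'm \<Rightarrow> real ^ 'p::finite) \<Rightarrow> nat \<Rightarrow> ennreal" where
  "network_error M H N =
     (INF \<Phi>\<in>{\<Phi>. relu_network CARD('m) CARD('p) \<Phi> \<and> network_size \<Phi> \<le> N}.
        L2_enorm M (\<lambda>x. network_fun \<Phi> x - H x))"

definition finite_dimensional_class :: "'a::real_vector set \<Rightarrow> bool" where
  "finite_dimensional_class W \<longleftrightarrow> (\<exists>B. finite B \<and> W \<subseteq> span B)"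

text \<open>A datum \<open>f \<in> D\<close> arises from the unknown \<open>G f\<close>.\<close>

definition data_generated_by :: "'x set \<Rightarrow> ('x \<Rightarrow> 'y) \<Rightarrow> 'y set \<Rightarrow> 'x set" where
  "data_generated_by D G W = {f \<in> D. G f \<in> W}"

end

theory Submission
  imports Defs
begin

text \<open>
  \<open>H\<close> is \<open>L\<close>-Lipschitz on \<open>K\<close>, so each component \<open>H\<^sub>c\<close> is approximated uniformly on \<open>K\<close> within
  \<open>2 * L * \<epsilon>\<close> by the infimal convolution \<open>x \<mapsto> min\<^sub>g (H\<^sub>c g + L * \<parallel>x - g\<parallel>\<^sub>1)\<close> over a finite
  \<open>\<epsilon>\<close>-net of \<open>K\<close>, which needs \<open>O(\<epsilon>\<^sup>-\<^sup>m)\<close> points. The cones are exact ReLU networks with two layers,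
  and a binary tree of pairwise minima has size linear in the number of points and depth
  logarithmic in it.
\<close>

text \<open>Distances are measured in the l1-norm because |t| = max t 0 + max (-t) 0 puts it exactly
  within reach of the activation; it dominates the Euclidean norm, so the constant \<open>L\<close>
  carries over. Minima of cones also avoid products, which a ReLU network could only approximate, so
  the spacing of the net is the only source of error. The obstacle is that an activation follows
  every hidden layer and cuts off negative numbers. Values pass unharmed only if they are
  nonnegative, so for each component the minimum over the net is subtracted in the cones and added
  back in the last layer, where no activation follows. To make the trees full, the net is enlarged
  by repetitions to a power of two, which costs a factor 2 in the size bound. Part (ii) follows from
  part (i) by choosing the accuracy as a function of \<open>N\<close> so that the size bound is at
  most \<open>N\<close>.\<close>

section \<open>Finite sums over sparse and block-shaped index sets\<close>

lemma sum_two_spikes: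
  fixes z :: "nat \<Rightarrow> real"
  assumes "a < n" "b < n" "a \<noteq> b"
  shows "(\<Sum>j<n. (if j = a then x else if j = b then y else 0) * z j) = x * z a + y * z b"
proof -
  have "(\<Sum>j<n. (if j = a then x else if j = b then y else 0) * z j) =
      (\<Sum>j<n. (if j = a then x * z j else 0) + (if j = b then y * z j else 0))"
    by (intro sum.cong) (use assms in auto)
  also have "\<dots> = x * z a + y * z b"
    using assms by (simp add: sum.distrib)
  finally show ?thesis .
qed

lemma sum_even_odd:
  fixes f :: "nat \<Rightarrow> real"
  shows "(\<Sum>l<2 * n. f l) = (\<Sum>t<n. f (2 * t) + f (2 * t + 1))"
  by (induction n) (simp_all add: algebra_simps)

text \<open>Pairs of units after \<open>dist_layer\<close> are numbered \<open>t = a * m + j\<close>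
  for point \<open>a\<close> and coordinate \<open>j\<close>, so a row of \<open>cone_layer\<close>
  supported on one block sums over the coordinates of one point.\<close>

lemma sum_div_block:
  fixes F :: "nat \<Rightarrow> real"
  assumes "a < n"
  shows "(\<Sum>t<m * n. if t div m = a then F (t mod m) else 0) = (\<Sum>j<m. F j)"
proof (cases "m = 0")
  case False
  have block: "{t \<in> {..<m * n}. t div m = a} = (\<lambda>j. a * m + j) ` {..<m}"
  proof (intro equalityI subsetI)
    fix t assume "t \<in> {t \<in> {..<m * n}. t div m = a}"
    then have "t = a * m + t mod m" "t mod m < m"
      using False by (auto simp: div_mult_mod_eq)
    then show "t \<in> (\<lambda>j. a * m + j) ` {..<m}" by blast
  next
    fix t assume "t \<in> (\<lambda>j. a * m + j) ` {..<m}"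
    then obtain j where j: "j < m" "t = a * m + j" by auto
    have "a * m + j < Suc a * m" using j by simp
    also have "\<dots> \<le> n * m" using assms by (intro mult_le_mono1) simp
    finally show "t \<in> {t \<in> {..<m * n}. t div m = a}"
      using j by (simp add: mult.commute)
  qed
  have "(\<Sum>t<m * n. if t div m = a then F (t mod m) else 0) =
      (\<Sum>t\<in>{t \<in> {..<m * n}. t div m = a}. F (t mod m))"
    by (rule sum.inter_filter [symmetric]) simp
  also have "\<dots> = (\<Sum>j<m. F j)"
    unfolding block by (subst sum.reindex) (auto intro!: inj_onI sum.cong)
  finally show ?thesis .
qed simp

text \<open>Counts the nonzero weights in a row of \<open>cone_layer\<close>: with
  \<open>n = 2 * m\<close>, the units of one point form an interval of that length.\<close>

lemma Collect_div_eq: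
  fixes n :: nat
  assumes "0 < n"
  shows "{l. l div n = a} = {n * a..<n * a + n}"
proof (intro equalityI subsetI)
  fix l assume "l \<in> {l. l div n = a}"
  then have "n * a + l mod n = l" by auto
  then show "l \<in> {n * a..<n * a + n}" using mod_less_divisor[OF assms, of l] unfolding atLeastLessThan_iff by linarith
next
  fix l assume "l \<in> {n * a..<n * a + n}"
  then show "l \<in> {l. l div n = a}" by (auto intro!: div_nat_eqI)
qed

subsection \<open>Networks\<close>

lemma realization_Cons:
  "\<Phi> \<noteq> [] \<Longrightarrow> realization (C # \<Phi>) z = realization \<Phi> (relu (affine C z))"
  by (cases \<Phi>) auto

text \<open>Counting row by row exploits sparsity, where the product of the widths would be
  quadratic in the number of points. The summand 1 pays for the bias; \<open>J\<close> may also
  contain columns out of range, which makes simple witnesses possible.\<close>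

lemma layer_size_le:
  assumes "\<And>i. i < dim_out C \<Longrightarrow> \<exists>J. finite J \<and> card J \<le> r \<and> (\<forall>j<dim_in C. weight C i j \<noteq> 0 \<longrightarrow> j \<in> J)"
  shows "layer_size C \<le> dim_out C * (r + 1)"
proof -
  obtain J where J: "\<And>i. i < dim_out C \<Longrightarrow> finite (J i) \<and> card (J i) \<le> r \<and>
      (\<forall>j<dim_in C. weight C i j \<noteq> 0 \<longrightarrow> j \<in> J i)"
    using assms by metis
  have "card {(i, j). i < dim_out C \<and> j < dim_in C \<and> weight C i j \<noteq> 0} \<le> card (SIGMA i:{..<dim_out C}. J i)"
    using J by (intro card_mono) (auto intro!: finite_SigmaI)
  also have "\<dots> = (\<Sum>i<dim_out C. card (J i))"
    using J by (intro card_SigmaI) auto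
  also have "\<dots> \<le> dim_out C * r"
    using sum_bounded_above[of "{..<dim_out C}" "\<lambda>i. card (J i)" r] J by simp
  finally have "card {(i, j). i < dim_out C \<and> j < dim_in C \<and> weight C i j \<noteq> 0} \<le> dim_out C * r" .
  moreover have "card {i. i < dim_out C \<and> bias C i \<noteq> 0} \<le> card {..<dim_out C}"
    by (intro card_mono) auto
  ultimately show ?thesis by (simp add: layer_size_def)
qed

text \<open>Needed for measurability of the error. The input is a function of \<open>x\<close>
  because the induction replaces it by the output of the first layer.\<close>

lemma continuous_on_realization:
  fixes f :: "'a::topological_space \<Rightarrow> nat \<Rightarrow> real"
  assumes "\<And>i. continuous_on S (\<lambda>x. f x i)"
  shows "continuous_on S (\<lambda>x. realization \<Phi> (f x) i)"
  using assms
proof (induction \<Phi> arbitrary: f i)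
  case Nil
  then show ?case by simp
next
  case (Cons C \<Phi>)
  have affine: "continuous_on S (\<lambda>x. affine C (f x) i)" for i
    by (cases "i < dim_out C") (auto simp: affine_def intro!: continuous_intros Cons.prems)
  show ?case
  proof (cases "\<Phi> = []")
    case True
    then show ?thesis using affine by simp
  next
    case False
    have "continuous_on S (\<lambda>x. relu (affine C (f x)) i)" for i
      unfolding relu_def by (intro continuous_intros affine)
    then show ?thesis
      using Cons.IH[of "\<lambda>x. relu (affine C (f x))"] False by (simp add: realization_Cons)
  qed
qed

lemma continuous_on_network_fun: "continuous_on S (network_fun \<Phi> :: real ^ 'm::finite \<Rightarrow> real ^ 'p::finite)"
proof -
  have "continuous_on S (\<lambda>x :: real ^ 'm. to_coords x i)" for i
    by (cases "i < CARD('m)") (auto simp: to_coords_def intro!: continuous_intros)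
  then show ?thesis
    unfolding network_fun_def of_coords_def
    by (intro continuous_on_vec_lambda continuous_on_realization)
qed

lemma of_coords_coord_enum: "c < CARD('p) \<Longrightarrow> (of_coords z :: real ^ 'p::finite) $ coord_enum c = z c"
  using bij_betw_coord_enum[where 'n = 'p]
  by (simp add: of_coords_def the_inv_into_f_f bij_betw_def)

subsection \<open>Minima by binary trees\<close>

text \<open>On nonnegative inputs \<open>min a b = b - max (b - a) 0\<close>, and applying \<open>max _ 0\<close> to \<open>b\<close> or to
  the result changes nothing. So two layers, each followed by an activation, replace
  \<open>2 * q\<close> nonnegative numbers by the \<open>q\<close> minima of consecutive pairs.\<close>

definition diff_layer :: "nat \<Rightarrow> layer" where
  "diff_layer q = Layer (2 * q) (2 * q)
     (\<lambda>i j. if j = 2 * (i div 2) + 1 then 1 else if j = 2 * (i div 2) then (if odd i then -1 else 0) else 0)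
     (\<lambda>i. 0)"

definition merge_layer :: "nat \<Rightarrow> layer" where
  "merge_layer q = Layer (2 * q) q
     (\<lambda>i j. if j = 2 * i then 1 else if j = 2 * i + 1 then -1 else 0) (\<lambda>i. 0)"

text \<open>The closing layer of the trees. Since no activation follows it, it can restore negative
  values.\<close>

definition shift_layer :: "nat \<Rightarrow> (nat \<Rightarrow> real) \<Rightarrow> layer" where
  "shift_layer p s = Layer p p (\<lambda>i j. if j = i then 1 else 0) s"

lemma pairwise_min_layers:
  assumes "\<And>i. i < 2 * q \<Longrightarrow> 0 \<le> v i" and "i < q"
  shows "relu (affine (merge_layer q) (relu (affine (diff_layer q) v))) i = min (v (2 * i)) (v (2 * i + 1))"
proof -
  have d: "affine (diff_layer q) v j = v (2 * (j div 2) + 1) + (if odd j then - v (2 * (j div 2)) else 0)"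
    if "j < 2 * q" for j
  proof -
    have "2 * (j div 2) + 1 < 2 * q" using that by presburger
    then show ?thesis
      using that by (simp add: affine_def diff_layer_def sum_two_spikes)
  qed
  have "affine (merge_layer q) u i = u (2 * i) - u (2 * i + 1)" for u
    using \<open>i < q\<close> by (simp add: affine_def merge_layer_def sum_two_spikes)
  moreover have "0 \<le> v (2 * i)" "0 \<le> v (2 * i + 1)"
    using assms by auto
  ultimately show ?thesis
    using \<open>i < q\<close> by (simp add: relu_def d max_def min_def)
qed

text \<open>\<open>p\<close> trees run side by side, each on a block of consecutive entries. Before
  every stage the blocks have even length, so no pair straddles two of them.\<close>

fun min_tree :: "nat \<Rightarrow> nat \<Rightarrow> layer list" where
  "min_tree p 0 = []"
| "min_tree p (Suc k) = diff_layer (p * 2 ^ k) # merge_layer (p * 2 ^ k) # min_tree p k"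

text \<open>The minimum over block \<open>i\<close> is expressed as a lower bound that is attained,
  the form in which it passes from one stage to the next. With \<open>shift_layer\<close> appended,
  every layer of the tree is followed by an activation, as \<open>pairwise_min_layers\<close>
  requires.\<close>

lemma realization_min_tree:
  fixes v s :: "nat \<Rightarrow> real"
  assumes "\<And>j. j < p * 2 ^ k \<Longrightarrow> 0 \<le> v j" and "i < p"
  defines "r \<equiv> realization (min_tree p k @ [shift_layer p s]) v i"
  shows "(\<forall>j. j div 2 ^ k = i \<longrightarrow> r \<le> v j + s i) \<and> (\<exists>j. j div 2 ^ k = i \<and> r = v j + s i)"
  using assms(1) unfolding r_def
proof (induction k arbitrary: v)
  case 0
  have "realization [shift_layer p s] v i = v i + s i"
    using \<open>i < p\<close> by (simp add: affine_def shift_layer_def if_distrib [of "\<lambda>x. x * _"] cong: if_cong)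
  then show ?case by simp
next
  case (Suc k)
  define w where "w = relu (affine (merge_layer (p * 2 ^ k)) (relu (affine (diff_layer (p * 2 ^ k)) v)))"
  have w: "w j = min (v (2 * j)) (v (2 * j + 1))" if "j < p * 2 ^ k" for j
    unfolding w_def using Suc.prems that by (intro pairwise_min_layers) (auto simp: mult_ac)
  have r: "realization (min_tree p (Suc k) @ [shift_layer p s]) v i =
      realization (min_tree p k @ [shift_layer p s]) w i"
    by (simp add: realization_Cons w_def)
  have nonneg: "0 \<le> w j" if "j < p * 2 ^ k" for j
    unfolding w[OF that] using that Suc.prems[of "2 * j"] Suc.prems[of "2 * j + 1"] by simp
  from Suc.IH[of w, OF nonneg] have
    le: "\<And>j. j div 2 ^ k = i \<Longrightarrow> realization (min_tree p k @ [shift_layer p s]) w i \<le> w j + s i" and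
    ex: "\<exists>j. j div 2 ^ k = i \<and> realization (min_tree p k @ [shift_layer p s]) w i = w j + s i"
    by blast+
  have bound: "j < p * 2 ^ k" if "j div 2 ^ k = i" for j :: nat
    using that \<open>i < p\<close> by (metis less_mult_imp_div_less div_less_iff_less_mult zero_less_numeral zero_less_power)
  \<comment> \<open>The parent of leaf \<open>j\<close> is \<open>j div 2\<close>, and it lies in
    the same block.\<close>
  have half: "j div 2 ^ Suc k = (j div 2) div 2 ^ k" for j :: nat
    by (simp add: div_mult2_eq)
  show ?case unfolding r
  proof (intro conjI allI impI)
    fix j :: nat assume "j div 2 ^ Suc k = i"
    then have j: "(j div 2) div 2 ^ k = i" by (simp only: half)
    have "j = 2 * (j div 2) \<or> j = 2 * (j div 2) + 1" by linarith
    then have "w (j div 2) \<le> v j"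
      unfolding w[OF bound[OF j]] by (metis min.cobounded1 min.cobounded2)
    then show "realization (min_tree p k @ [shift_layer p s]) w i \<le> v j + s i"
      using le[OF j] by simp
  next
    from ex obtain j where j: "j div 2 ^ k = i"
      and eq: "realization (min_tree p k @ [shift_layer p s]) w i = w j + s i" by blast
    have "w j = v (2 * j) \<or> w j = v (2 * j + 1)"
      unfolding w[OF bound[OF j]] by (auto simp: min_def)
    moreover have "(2 * j) div 2 ^ Suc k = i" "(2 * j + 1) div 2 ^ Suc k = i"
      using j by (simp_all add: half del: power_Suc)
    ultimately show "\<exists>j. j div 2 ^ Suc k = i \<and> realization (min_tree p k @ [shift_layer p s]) w i = v j + s i"
      using eq by metis
  qed
qed

lemma layer_size_diff_layer: "layer_size (diff_layer q) \<le> 6 * q"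
proof -
  have "\<exists>J. finite J \<and> card J \<le> 2 \<and> (\<forall>j<dim_in (diff_layer q). weight (diff_layer q) i j \<noteq> 0 \<longrightarrow> j \<in> J)" for i
    by (rule exI[of _ "{2 * (i div 2) + 1, 2 * (i div 2)}"]) (auto simp: diff_layer_def card_insert_if)
  then show ?thesis
    using layer_size_le[of "diff_layer q" 2] by (simp add: diff_layer_def)
qed

lemma layer_size_merge_layer: "layer_size (merge_layer q) \<le> 3 * q"
proof -
  have "\<exists>J. finite J \<and> card J \<le> 2 \<and> (\<forall>j<dim_in (merge_layer q). weight (merge_layer q) i j \<noteq> 0 \<longrightarrow> j \<in> J)" for i
    by (rule exI[of _ "{2 * i, 2 * i + 1}"]) (auto simp: merge_layer_def card_insert_if)
  then show ?thesis
    using layer_size_le[of "merge_layer q" 2] by (simp add: merge_layer_def)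
qed

lemma layer_size_shift_layer: "layer_size (shift_layer p s) \<le> 2 * p"
proof -
  have "\<exists>J. finite J \<and> card J \<le> 1 \<and> (\<forall>j<dim_in (shift_layer p s). weight (shift_layer p s) i j \<noteq> 0 \<longrightarrow> j \<in> J)" for i
    by (rule exI[of _ "{i}"]) (auto simp: shift_layer_def)
  then show ?thesis
    using layer_size_le[of "shift_layer p s" 1] by (simp add: shift_layer_def)
qed

text \<open>A stage with \<open>q\<close> outputs costs at most 6 * q + 3 * q, and the geometric sum
  of the stages is 9 * p * (2 ^ k - 1); the additive form avoids subtraction on
  \<open>nat\<close>.\<close>

lemma network_size_min_tree: "network_size (min_tree p k) + 9 * p \<le> 9 * (p * 2 ^ k)"
proof (induction k)
  case (Suc k)
  then show ?case
    using layer_size_diff_layer[of "p * 2 ^ k"] layer_size_merge_layer[of "p * 2 ^ k"]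
    by (simp add: network_size_def)
qed (simp add: network_size_def)

lemma length_min_tree: "length (min_tree p k) = 2 * k"
  by (induction k) auto

lemma relu_network_min_tree:
  "0 < p \<Longrightarrow> relu_network (p * 2 ^ k) p (min_tree p k @ [shift_layer p s])"
proof (induction k)
  case (Suc k)
  obtain C \<Phi> where C: "min_tree p k @ [shift_layer p s] = C # \<Phi>"
    by (cases "min_tree p k @ [shift_layer p s]") auto
  with Suc show ?case
    by (auto simp: relu_network_def diff_layer_def merge_layer_def)
qed (simp add: relu_network_def shift_layer_def)

subsection \<open>The network of an infimal convolution\<close>

text \<open>Row \<open>i\<close> of \<open>dist_layer\<close> belongs to the point \<open>i div 2 div m\<close>, the coordinate \<open>i div 2 mod m\<close>
  and a sign, namely the parity of \<open>i\<close>.\<close>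

definition dist_layer :: "nat \<Rightarrow> nat \<Rightarrow> (nat \<Rightarrow> nat \<Rightarrow> real) \<Rightarrow> layer" where
  "dist_layer m n g = Layer m (2 * (m * n))
     (\<lambda>i j. if j = i div 2 mod m then (if even i then 1 else -1) else 0)
     (\<lambda>i. (if even i then -1 else 1) * g (i div 2 div m) (i div 2 mod m))"

text \<open>Row \<open>i\<close> is the cone of component \<open>i div n\<close> with apex at point
  \<open>i mod n\<close>; this order produces the contiguous blocks that \<open>min_tree\<close>
  reduces. The coordinate distances are shared by all components.\<close>

definition cone_layer :: "nat \<Rightarrow> nat \<Rightarrow> nat \<Rightarrow> real \<Rightarrow> (nat \<Rightarrow> nat \<Rightarrow> real) \<Rightarrow> layer" where
  "cone_layer m n p L b = Layer (2 * (m * n)) (p * n)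
     (\<lambda>i l. if l div 2 div m = i mod n then L else 0) (\<lambda>i. b (i div n) (i mod n))"

definition mcshane_network ::
  "nat \<Rightarrow> nat \<Rightarrow> nat \<Rightarrow> real \<Rightarrow> (nat \<Rightarrow> nat \<Rightarrow> real) \<Rightarrow> (nat \<Rightarrow> nat \<Rightarrow> real) \<Rightarrow> (nat \<Rightarrow> real) \<Rightarrow> layer list" where
  "mcshane_network m p k L g b s =
     dist_layer m (2 ^ k) g # cone_layer m (2 ^ k) p L b # min_tree p k @ [shift_layer p s]"

lemma affine_cone_dist:
  assumes "0 < m" "0 < n" "i < p * n"
  shows "affine (cone_layer m n p L b) (relu (affine (dist_layer m n g) z)) i =
    b (i div n) (i mod n) + L * (\<Sum>j<m. \<bar>z j - g (i mod n) j\<bar>)"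
proof -
  define a where "a = i mod n"
  define u where "u = relu (affine (dist_layer m n g) z)"
  have d: "affine (dist_layer m n g) z l =
      (if even l then 1 else -1) * (z (l div 2 mod m) - g (l div 2 div m) (l div 2 mod m))"
    if "l < 2 * (m * n)" for l
    using that \<open>0 < m\<close>
    by (simp add: affine_def dist_layer_def if_distrib [of "\<lambda>x. x * _"] cong: if_cong)
  \<comment> \<open>The two units carry opposite arguments, and their positive parts add up to the
    absolute value.\<close>
  have u: "u (2 * t) + u (2 * t + 1) = \<bar>z (t mod m) - g (t div m) (t mod m)\<bar>" if "t < m * n" for t
    using that by (simp add: u_def relu_def d)
  have "(\<Sum>l<2 * (m * n). (if l div 2 div m = a then L else 0) * u l) =
      (\<Sum>t<m * n. (if t div m = a then L else 0) * u (2 * t) + (if t div m = a then L else 0) * u (2 * t + 1))"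
    by (subst sum_even_odd) simp
  also have "\<dots> = (\<Sum>t<m * n. if t div m = a then L * \<bar>z (t mod m) - g a (t mod m)\<bar> else 0)"
    using u by (intro sum.cong) (auto simp: distrib_left [symmetric])
  also have "\<dots> = (\<Sum>j<m. L * \<bar>z j - g a j\<bar>)"
    by (rule sum_div_block) (use assms in \<open>simp add: a_def\<close>)
  finally show ?thesis
    using assms by (simp add: affine_def cone_layer_def a_def u_def sum_distrib_left)
qed

text \<open>With nonnegative offsets \<open>b\<close> all cones are nonnegative, so the activation
  after \<open>cone_layer\<close> does not change them.\<close>

lemma realization_mcshane_network:
  fixes b g :: "nat \<Rightarrow> nat \<Rightarrow> real" and z s :: "nat \<Rightarrow> real"
  assumes "0 < m" "0 \<le> L" "c < p" and b: "\<And>c a. c < p \<Longrightarrow> a < 2 ^ k \<Longrightarrow> 0 \<le> b c a"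
  defines "V \<equiv> \<lambda>a. b c a + L * (\<Sum>j<m. \<bar>z j - g a j\<bar>) + s c"
    and "r \<equiv> realization (mcshane_network m p k L g b s) z c"
  shows "\<And>a. a < 2 ^ k \<Longrightarrow> r \<le> V a" and "\<exists>a<2 ^ k. r = V a"
proof -
  define v where "v = relu (affine (cone_layer m (2 ^ k) p L b) (relu (affine (dist_layer m (2 ^ k) g) z)))"
  have v: "v i = b (i div 2 ^ k) (i mod 2 ^ k) + L * (\<Sum>j<m. \<bar>z j - g (i mod 2 ^ k) j\<bar>)"
    if "i < p * 2 ^ k" for i
  proof -
    have "0 \<le> b (i div 2 ^ k) (i mod 2 ^ k)"
      using that by (intro b) (auto simp: less_mult_imp_div_less)
    then have "0 \<le> b (i div 2 ^ k) (i mod 2 ^ k) + L * (\<Sum>j<m. \<bar>z j - g (i mod 2 ^ k) j\<bar>)"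
      using \<open>0 \<le> L\<close> by (intro add_nonneg_nonneg mult_nonneg_nonneg sum_nonneg) auto
    then show ?thesis
      using affine_cone_dist[OF \<open>0 < m\<close> _ that, of L b g z] by (simp add: v_def relu_def [of "affine (cone_layer _ _ _ _ _) _"])
  qed
  have r: "r = realization (min_tree p k @ [shift_layer p s]) v c"
    by (simp add: r_def mcshane_network_def realization_Cons v_def)
  have "0 \<le> v j" for j
    by (simp add: v_def relu_def)
  note tree = realization_min_tree[of p k v c s, OF this \<open>c < p\<close>, folded r]
  have bound: "j < p * 2 ^ k" if "j div 2 ^ k = c" for j :: nat
    using that \<open>c < p\<close> by (metis div_less_iff_less_mult zero_less_numeral zero_less_power)
  have V: "v j + s c = V (j mod 2 ^ k)" if "j div 2 ^ k = c" for j
    using v[OF bound[OF that]] that by (simp add: V_def)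
  show "r \<le> V a" if "a < 2 ^ k" for a
  proof -
    \<comment> \<open>The leaf of point \<open>a\<close> in the tree of component
      \<open>c\<close>.\<close>
    have "(c * 2 ^ k + a) div 2 ^ k = c" "(c * 2 ^ k + a) mod 2 ^ k = a"
      using that by simp_all
    then show ?thesis using tree V by metis
  qed
  show "\<exists>a<2 ^ k. r = V a"
    using tree V by (metis mod_less_divisor zero_less_numeral zero_less_power)
qed

lemma relu_network_mcshane_network:
  assumes "0 < m" "0 < p"
  shows "relu_network m p (mcshane_network m p k L g b s)"
proof -
  obtain C \<Phi> where C: "min_tree p k @ [shift_layer p s] = C # \<Phi>"
    by (cases "min_tree p k @ [shift_layer p s]") auto
  with relu_network_min_tree[OF \<open>0 < p\<close>, of k s] assms show ?thesis
    by (auto simp: relu_network_def mcshane_network_def dist_layer_def cone_layer_def)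
qed

text \<open>Each point has 2 * m rows in \<open>dist_layer\<close> with one weight and one bias. Per
  point and component, the cone costs 2 * m + 1, the tree 9, and the closing shift 2 after
  estimating \<open>p\<close> by \<open>p * 2 ^ k\<close>.\<close>

lemma network_size_mcshane_network:
  assumes "0 < m"
  shows "network_size (mcshane_network m p k L g b s) \<le> (4 * m + p * (2 * m + 12)) * 2 ^ k"
proof -
  have "\<exists>J. finite J \<and> card J \<le> 1 \<and>
      (\<forall>j<dim_in (dist_layer m (2 ^ k) g). weight (dist_layer m (2 ^ k) g) i j \<noteq> 0 \<longrightarrow> j \<in> J)" for i
    by (rule exI[of _ "{i div 2 mod m}"]) (auto simp: dist_layer_def)
  then have 1: "layer_size (dist_layer m (2 ^ k) g) \<le> 4 * m * 2 ^ k"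
    using layer_size_le[of "dist_layer m (2 ^ k) g" 1] by (simp add: dist_layer_def mult_ac)
  have "\<exists>J. finite J \<and> card J \<le> 2 * m \<and>
      (\<forall>j<dim_in (cone_layer m (2 ^ k) p L b). weight (cone_layer m (2 ^ k) p L b) i j \<noteq> 0 \<longrightarrow> j \<in> J)" for i
  proof (rule exI[of _ "{l. l div 2 div m = i mod 2 ^ k}"])
    have "{l. l div 2 div m = i mod 2 ^ k} = {l. l div (2 * m) = i mod 2 ^ k}"
      by (simp add: div_mult2_eq)
    also have "\<dots> = {2 * m * (i mod 2 ^ k)..<2 * m * (i mod 2 ^ k) + 2 * m}"
      using \<open>0 < m\<close> by (intro Collect_div_eq) simp
    finally show "finite {l. l div 2 div m = i mod 2 ^ k} \<and> card {l. l div 2 div m = i mod 2 ^ k} \<le> 2 * m \<and>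
      (\<forall>j<dim_in (cone_layer m (2 ^ k) p L b). weight (cone_layer m (2 ^ k) p L b) i j \<noteq> 0 \<longrightarrow>
        j \<in> {l. l div 2 div m = i mod 2 ^ k})"
      by (auto simp: cone_layer_def split: if_splits)
  qed
  then have 2: "layer_size (cone_layer m (2 ^ k) p L b) \<le> p * (2 * m + 1) * 2 ^ k"
    using layer_size_le[of "cone_layer m (2 ^ k) p L b" "2 * m"] by (simp add: cone_layer_def algebra_simps)
  have "p \<le> p * 2 ^ k" by simp
  then show ?thesis
    using 1 2 network_size_min_tree[of p k] layer_size_shift_layer[of p s]
    by (simp add: mcshane_network_def network_size_def algebra_simps)
qed

lemma network_depth_mcshane_network: "network_depth (mcshane_network m p k L g b s) = 2 * k + 2"
  by (simp add: network_depth_def mcshane_network_def length_min_tree)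

subsection \<open>Approximation of Lipschitz maps\<close>

text \<open>The net has to lie in \<open>K\<close>, where the Lipschitz bound holds, so it takes one
  representative of \<open>K\<close> from each occupied cell of a grid of side \<epsilon> / m.
  Points of one cell differ by at most \<epsilon> / m in each of the m coordinates.\<close>

lemma l1_net:
  fixes K :: "(real ^ 'm::finite) set"
  assumes "bounded K"
  obtains B where "0 < B"
    and "\<And>\<epsilon>. 0 < \<epsilon> \<Longrightarrow> \<epsilon> \<le> 1 \<Longrightarrow> \<exists>F\<subseteq>K. finite F \<and> real (card F) \<le> B * (1 / \<epsilon>) ^ CARD('m) \<and>
      (\<forall>x\<in>K. \<exists>y\<in>F. (\<Sum>k\<in>UNIV. \<bar>x $ k - y $ k\<bar>) \<le> \<epsilon>)"
proof -
  obtain R where "R > 0" and R: "\<And>x. x \<in> K \<Longrightarrow> norm x \<le> R"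
    using assms bounded_pos by blast
  define m where "m = real CARD('m)"
  have "m > 0" by (simp add: m_def)
  show ?thesis
  proof
    \<comment> \<open>Cell indices range over \<open>{-M..M}\<close> with M at most R * m /
      \<epsilon> + 1, and \<epsilon> <= 1 turns the count 2 * M + 1 into at most (2 * R * m + 3) /
      \<epsilon> per coordinate.\<close>
    show "0 < (2 * R * m + 3) ^ CARD('m)"
      using \<open>R > 0\<close> \<open>m > 0\<close> by (intro zero_less_power add_nonneg_pos mult_nonneg_nonneg) auto
    fix \<epsilon> :: real assume "0 < \<epsilon>" "\<epsilon> \<le> 1"
    define q where "q = (\<lambda>(x :: real ^ 'm) k. \<lfloor>x $ k * m / \<epsilon>\<rfloor>)"
    define M where "M = \<lceil>R * m / \<epsilon>\<rceil>"
    define F where "F = inv_into K q ` q ` K"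
    have "M \<ge> 0" using \<open>R > 0\<close> \<open>m > 0\<close> \<open>0 < \<epsilon>\<close> unfolding M_def
      by (subst zero_le_ceiling) (auto intro: less_trans[of _ 0])
    have "q x k \<in> {-M..M}" if "x \<in> K" for x k
    proof -
      have "\<bar>x $ k\<bar> \<le> R" using component_le_norm_cart[of x k] R[OF that] by simp
      then have "\<bar>x $ k\<bar> * m / \<epsilon> \<le> R * m / \<epsilon>"
        using \<open>m > 0\<close> \<open>0 < \<epsilon>\<close> by (intro divide_right_mono mult_right_mono) auto
      moreover have "\<bar>x $ k * m / \<epsilon>\<bar> = \<bar>x $ k\<bar> * m / \<epsilon>"
        using \<open>m > 0\<close> \<open>0 < \<epsilon>\<close> by (simp add: abs_mult)
      ultimately have "\<bar>x $ k * m / \<epsilon>\<bar> \<le> R * m / \<epsilon>" by simp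
      then have "\<bar>x $ k * m / \<epsilon>\<bar> \<le> real_of_int M"
        unfolding M_def by linarith
      then show ?thesis unfolding q_def atLeastAtMost_iff le_floor_iff floor_le_iff abs_le_iff by simp
    qed
    then have sub: "q ` K \<subseteq> (\<Pi>\<^sub>E k\<in>UNIV. {-M..M})" by (auto simp: PiE_def)
    have fin: "finite (\<Pi>\<^sub>E k\<in>(UNIV :: 'm set). {-M..M})" by (intro finite_PiE) auto
    have "card F \<le> card (q ` K)"
      unfolding F_def using finite_subset[OF sub fin] by (rule card_image_le)
    also have "\<dots> \<le> card (\<Pi>\<^sub>E k\<in>(UNIV :: 'm set). {-M..M})"
      using fin sub by (rule card_mono)
    also have "\<dots> = nat (2 * M + 1) ^ CARD('m)"
      by (simp add: card_PiE)
    finally have "real (card F) \<le> real (nat (2 * M + 1)) ^ CARD('m)"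
      by (metis of_nat_le_iff of_nat_power)
    also have "\<dots> \<le> ((2 * R * m + 3) * (1 / \<epsilon>)) ^ CARD('m)"
    proof (rule power_mono)
      have "real_of_int M \<le> R * m / \<epsilon> + 1" by (unfold M_def, linarith)
      moreover have "1 \<le> 1 / \<epsilon>" using \<open>0 < \<epsilon>\<close> \<open>\<epsilon> \<le> 1\<close> by simp
      ultimately have "2 * real_of_int M + 1 \<le> 2 * (R * m / \<epsilon>) + 3 * (1 / \<epsilon>)" by linarith
      also have "\<dots> = (2 * R * m + 3) * (1 / \<epsilon>)" by (simp add: algebra_simps)
      finally show "real (nat (2 * M + 1)) \<le> (2 * R * m + 3) * (1 / \<epsilon>)" using \<open>M \<ge> 0\<close> by simp
    qed simp
    also have "\<dots> = (2 * R * m + 3) ^ CARD('m) * (1 / \<epsilon>) ^ CARD('m)" by (rule power_mult_distrib)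
    finally have card: "real (card F) \<le> (2 * R * m + 3) ^ CARD('m) * (1 / \<epsilon>) ^ CARD('m)" .
    have net: "\<exists>y\<in>F. (\<Sum>k\<in>UNIV. \<bar>x $ k - y $ k\<bar>) \<le> \<epsilon>" if "x \<in> K" for x
    proof (rule bexI[of _ "inv_into K q (q x)"])
      define y where "y = inv_into K q (q x)"
      have "q y = q x" unfolding y_def using that by (intro f_inv_into_f) auto
      have "\<bar>x $ k - y $ k\<bar> \<le> \<epsilon> / m" for k
      proof -
        have "\<lfloor>x $ k * m / \<epsilon>\<rfloor> = \<lfloor>y $ k * m / \<epsilon>\<rfloor>"
          using fun_cong[OF \<open>q y = q x\<close>, of k] by (simp add: q_def)
        then have "\<bar>x $ k * m / \<epsilon> - y $ k * m / \<epsilon>\<bar> \<le> 1" by linarith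
        also have "x $ k * m / \<epsilon> - y $ k * m / \<epsilon> = (x $ k - y $ k) * (m / \<epsilon>)"
          by (simp add: algebra_simps)
        finally have "\<bar>x $ k - y $ k\<bar> * (m / \<epsilon>) \<le> 1"
          using \<open>m > 0\<close> \<open>0 < \<epsilon>\<close> by (simp add: abs_mult)
        then show ?thesis
          using \<open>m > 0\<close> \<open>0 < \<epsilon>\<close> by (simp add: field_simps)
      qed
      then have "(\<Sum>k\<in>UNIV. \<bar>x $ k - y $ k\<bar>) \<le> of_nat (card (UNIV :: 'm set)) * (\<epsilon> / m)"
        by (intro sum_bounded_above) auto
      then show "(\<Sum>k\<in>UNIV. \<bar>x $ k - inv_into K q (q x) $ k\<bar>) \<le> \<epsilon>"
        using \<open>m > 0\<close> by (simp add: m_def y_def)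
      show "inv_into K q (q x) \<in> F" using that by (auto simp: F_def)
    qed
    have "F \<subseteq> K" by (auto simp: F_def inv_into_into)
    then show "\<exists>F\<subseteq>K. finite F \<and> real (card F) \<le> (2 * R * m + 3) ^ CARD('m) * (1 / \<epsilon>) ^ CARD('m) \<and>
      (\<forall>x\<in>K. \<exists>y\<in>F. (\<Sum>k\<in>UNIV. \<bar>x $ k - y $ k\<bar>) \<le> \<epsilon>)"
      using card net finite_subset[OF sub fin] by (intro exI[of _ F]) (auto simp: F_def)
  qed
qed

text \<open>Pads the net to the number of leaves of a full tree. Indices beyond the leaves also map
  into \<open>F\<close>, so facts about net points hold for \<open>g a\<close> without a bound on
  \<open>a\<close>.\<close>

lemma finite_set_enumeration_with_repetition:
  assumes "finite F" "F \<noteq> {}" "card F \<le> n"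
  obtains g :: "nat \<Rightarrow> 'a" where "range g = F" "g ` {..<n} = F"
proof -
  obtain e where e: "bij_betw e {..<card F} F"
    using ex_bij_betw_nat_finite[OF \<open>finite F\<close>] by (auto simp: atLeast0LessThan)
  have "0 < card F" using assms by (simp add: card_gt_0_iff)
  define g where "g = (\<lambda>a. e (if a < card F then a else 0))"
  have "e ` {..<card F} = F" using e by (simp add: bij_betw_def)
  then have "g a \<in> F" for a using \<open>0 < card F\<close> by (auto simp: g_def)
  moreover have "F \<subseteq> g ` {..<n}"
  proof
    fix y assume "y \<in> F"
    then obtain a where "a < card F" "y = e a"
      using \<open>e ` {..<card F} = F\<close> by auto
    then show "y \<in> g ` {..<n}" using \<open>card F \<le> n\<close> by (auto simp: g_def image_iff intro!: bexI[of _ a])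
  qed
  ultimately show thesis by (intro that[of g]) auto
qed

text \<open>The network realizes McShane's formula: a function \<open>f\<close> that is \<open>L\<close>-Lipschitz on \<open>K\<close> satisfies
  \<open>f x \<le> f y + L * dist x y\<close> for all \<open>y \<in> K\<close>, and the right-hand side is at most
  \<open>f x + 2 * L * dist x y\<close>.\<close>

lemma lipschitz_network_from_net:
  fixes H :: "real ^ 'm::finite \<Rightarrow> real ^ 'p::finite" and L \<epsilon> :: real
  assumes "0 \<le> L" and lip: "\<And>x y. x \<in> K \<Longrightarrow> y \<in> K \<Longrightarrow> norm (H x - H y) \<le> L * norm (x - y)"
    and F: "F \<subseteq> K" "finite F" "F \<noteq> {}" "card F \<le> 2 ^ k"
    and net: "\<And>x. x \<in> K \<Longrightarrow> \<exists>y\<in>F. (\<Sum>k\<in>UNIV. \<bar>x $ k - y $ k\<bar>) \<le> \<epsilon>"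
  obtains \<Phi> where "relu_network CARD('m) CARD('p) \<Phi>"
    and "\<And>x. x \<in> K \<Longrightarrow> norm (network_fun \<Phi> x - H x) \<le> real CARD('p) * (2 * L * \<epsilon>)"
    and "network_size \<Phi> \<le> (4 * CARD('m) + CARD('p) * (2 * CARD('m) + 12)) * 2 ^ k"
    and "network_depth \<Phi> = 2 * k + 2"
proof -
  obtain g :: "nat \<Rightarrow> real ^ 'm" where g: "range g = F" "g ` {..<2 ^ k :: nat} = F"
    using finite_set_enumeration_with_repetition[OF F(2-4)] .
  define f :: "nat \<Rightarrow> real ^ 'm \<Rightarrow> real" where "f c x = H x $ coord_enum c" for c x
  \<comment> \<open>Subtracting the minimum over the net makes the offsets of the cones nonnegative;
    \<open>shift_layer\<close> adds it back.\<close>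
  define s where "s = (\<lambda>c. Min (f c ` F))"
  define \<Phi> where "\<Phi> = mcshane_network CARD('m) CARD('p) k L (\<lambda>a. to_coords (g a)) (\<lambda>c a. f c (g a) - s c) s"
  have flip: "\<bar>f c x - f c y\<bar> \<le> L * (\<Sum>k\<in>UNIV. \<bar>x $ k - y $ k\<bar>)" if "x \<in> K" "y \<in> K" for c x y
  proof -
    have "\<bar>f c x - f c y\<bar> \<le> norm (H x - H y)"
      using component_le_norm_cart[of "H x - H y" "coord_enum c"] by (simp add: f_def)
    also have "\<dots> \<le> L * norm (x - y)" using lip that .
    also have "\<dots> \<le> L * (\<Sum>k\<in>UNIV. \<bar>x $ k - y $ k\<bar>)"
      using norm_le_l1_cart[of "x - y"] \<open>0 \<le> L\<close> by (intro mult_left_mono) auto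
    finally show ?thesis .
  qed
  have l1: "(\<Sum>j<CARD('m). \<bar>to_coords x j - to_coords y j\<bar>) = (\<Sum>k\<in>UNIV. \<bar>x $ k - y $ k\<bar>)"
    for x y :: "real ^ 'm"
    using sum.reindex_bij_betw[OF bij_betw_coord_enum[where 'n = 'm], of "\<lambda>k. \<bar>x $ k - y $ k\<bar>"]
    by (simp add: to_coords_def)
  have err: "\<bar>network_fun \<Phi> x $ i - H x $ i\<bar> \<le> 2 * L * \<epsilon>" if "x \<in> K" for x and i :: 'p
  proof -
    obtain c where c: "c < CARD('p)" "i = coord_enum c"
      using bij_betw_coord_enum[where 'n = 'p] unfolding bij_betw_def by blast
    define r where "r = network_fun \<Phi> x $ i"
    define V where "V = (\<lambda>a. f c (g a) - s c + L * (\<Sum>j<CARD('m). \<bar>to_coords x j - to_coords (g a) j\<bar>) + s c)"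
    have V: "V a = f c (g a) + L * (\<Sum>k\<in>UNIV. \<bar>x $ k - g a $ k\<bar>)" for a
      by (simp add: V_def l1)
    have "0 \<le> f c (g a) - s c" for c a
      using F g by (auto simp: s_def intro!: Min_le)
    note mcshane = realization_mcshane_network[where b = "\<lambda>c a. f c (g a) - s c" and
        g = "\<lambda>a. to_coords (g a)" and z = "to_coords x" and s = s and k = k, OF _ \<open>0 \<le> L\<close> c(1) this]
    have r: "r = realization \<Phi> (to_coords x) c"
      by (simp add: r_def c network_fun_def of_coords_coord_enum)
    have le: "r \<le> V a" if "a < 2 ^ k" for a
      unfolding r \<Phi>_def V_def using that by (intro mcshane(1)) auto
    have "\<exists>a<2 ^ k. r = V a"
      unfolding r \<Phi>_def V_def by (intro mcshane(2)) auto
    then obtain a' where a': "r = V a'" by blast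
    have gK: "g a \<in> K" for a using F g by auto
    have "f c x \<le> r"
      using flip[OF \<open>x \<in> K\<close> gK[of a'], of c] by (simp add: a' V)
    obtain a where a: "a < 2 ^ k" "(\<Sum>k\<in>UNIV. \<bar>x $ k - g a $ k\<bar>) \<le> \<epsilon>"
      using net[OF \<open>x \<in> K\<close>] unfolding g(2) [symmetric] by blast
    have "r \<le> f c x + 2 * (L * (\<Sum>k\<in>UNIV. \<bar>x $ k - g a $ k\<bar>))"
      using le[OF a(1)] flip[OF \<open>x \<in> K\<close> gK[of a], of c] by (simp add: V)
    also have "L * (\<Sum>k\<in>UNIV. \<bar>x $ k - g a $ k\<bar>) \<le> L * \<epsilon>"
      using a \<open>0 \<le> L\<close> by (intro mult_left_mono)
    finally show ?thesis
      using \<open>f c x \<le> r\<close> by (simp add: r_def c f_def)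
  qed
  show thesis
  proof
    show "relu_network CARD('m) CARD('p) \<Phi>"
      unfolding \<Phi>_def by (rule relu_network_mcshane_network) auto
    show "network_size \<Phi> \<le> (4 * CARD('m) + CARD('p) * (2 * CARD('m) + 12)) * 2 ^ k"
      unfolding \<Phi>_def by (rule network_size_mcshane_network) auto
    show "network_depth \<Phi> = 2 * k + 2"
      unfolding \<Phi>_def by (rule network_depth_mcshane_network)
    fix x assume "x \<in> K"
    have "norm (network_fun \<Phi> x - H x) \<le> (\<Sum>i\<in>UNIV. \<bar>(network_fun \<Phi> x - H x) $ i\<bar>)"
      by (rule norm_le_l1_cart)
    also have "\<dots> \<le> of_nat (card (UNIV :: 'p set)) * (2 * L * \<epsilon>)"
      using err[OF \<open>x \<in> K\<close>] by (intro sum_bounded_above) auto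
    finally show "norm (network_fun \<Phi> x - H x) \<le> real CARD('p) * (2 * L * \<epsilon>)" by simp
  qed
qed

text \<open>Rounds a bound on the number of net points up to a number of leaves, at the cost of a
  factor 2 in size and at most one more level.\<close>

lemma ex_power2_between:
  assumes "1 \<le> (t :: real)"
  obtains k :: nat where "t \<le> 2 ^ k" "2 ^ k \<le> 2 * t" "real k \<le> 1 + ln t / ln 2"
proof
  define k where "k = nat \<lceil>log 2 t\<rceil>"
  have "0 \<le> log 2 t" using assms by simp
  then have k: "log 2 t \<le> real k" "real k \<le> log 2 t + 1"
    unfolding k_def by linarith+
  show "t \<le> 2 ^ k"
    using k(1) assms by (simp add: log_le_iff powr_realpow)
  have "2 powr real k \<le> 2 powr (log 2 t + 1)" using k(2) by simp
  also have "\<dots> = 2 * t" using assms by (simp add: powr_add)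
  finally show "2 ^ k \<le> 2 * t" by (simp add: powr_realpow)
  show "real k \<le> 1 + ln t / ln 2" using k(2) by (simp add: log_def)
qed

lemma lipschitz_network_approximation:
  fixes H :: "real ^ 'm::finite \<Rightarrow> real ^ 'p::finite"
  assumes "bounded K" and lip: "\<And>x y. x \<in> K \<Longrightarrow> y \<in> K \<Longrightarrow> norm (H x - H y) \<le> L * norm (x - y)"
  shows "\<exists>c\<^sub>0 c\<^sub>1 c\<^sub>2 :: real. c\<^sub>0 > 0 \<and> c\<^sub>1 > 0 \<and> c\<^sub>2 > 0 \<and>
    (\<forall>\<eta>. 0 < \<eta> \<and> \<eta> < 1 \<longrightarrow>
      (\<exists>\<Phi>. relu_network CARD('m) CARD('p) \<Phi> \<and>
        (\<forall>x\<in>K. norm (network_fun \<Phi> x - H x) \<le> \<eta>) \<and>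
        real (network_size \<Phi>) \<le> c\<^sub>0 * (1 / \<eta>) ^ CARD('m) \<and>
        real (network_depth \<Phi>) \<le> c\<^sub>1 + c\<^sub>2 * (real CARD('m) * ln (1 / \<eta>))))"
proof -
  \<comment> \<open>A tree needs a leaf, so an empty \<open>K\<close> is replaced by a single point.
    The bound 1 <= \<open>L'\<close> yields 1 <= \<open>a\<close> below, hence \<epsilon> <= 1 as
    \<open>l1_net\<close> demands.\<close>
  define K' where "K' = (if K = {} then {0} else K)"
  define L' where "L' = max 1 L"
  have K': "bounded K'" "K' \<noteq> {}" "K \<subseteq> K'"
    using \<open>bounded K\<close> by (auto simp: K'_def)
  have "1 \<le> L'" by (simp add: L'_def)
  have lip': "norm (H x - H y) \<le> L' * norm (x - y)" if "x \<in> K'" "y \<in> K'" for x y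
  proof (cases "K = {}")
    case True
    then show ?thesis using that by (simp add: K'_def)
  next
    case False
    then have "norm (H x - H y) \<le> L * norm (x - y)" using that by (intro lip) (auto simp: K'_def)
    also have "\<dots> \<le> L' * norm (x - y)" by (intro mult_right_mono) (auto simp: L'_def)
    finally show ?thesis .
  qed
  obtain B where "0 < B" and B: "\<And>\<epsilon>. 0 < \<epsilon> \<Longrightarrow> \<epsilon> \<le> 1 \<Longrightarrow> \<exists>F\<subseteq>K'. finite F \<and>
      real (card F) \<le> B * (1 / \<epsilon>) ^ CARD('m) \<and> (\<forall>x\<in>K'. \<exists>y\<in>F. (\<Sum>k\<in>UNIV. \<bar>x $ k - y $ k\<bar>) \<le> \<epsilon>)"
    using l1_net[OF K'(1)] by blast
  define m where "m = CARD('m)"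
  \<comment> \<open>The ratio of network error to net spacing: \<open>2 * L'\<close> for each
    component, times the number of components.\<close>
  define a where "a = real CARD('p) * (2 * L')"
  have "1 * 1 \<le> real CARD('p) * (2 * L')"
    using \<open>1 \<le> L'\<close> by (intro mult_mono) (auto simp: Suc_leI)
  then have "1 \<le> a" by (simp add: a_def)
  \<comment> \<open>The factor \<open>a ^ m\<close> converts a power of 1 / \<epsilon> into one of 1
    / \<eta>; the maximum ensures 1 <= \<open>t\<close>.\<close>
  define B' where "B' = max 1 B * a ^ m"
  have "1 \<le> B'" using mult_mono[of 1 "max 1 B" 1 "a ^ m"] \<open>1 \<le> a\<close> by (simp add: B'_def)
  \<comment> \<open>The factor 2 is the rounding to a power of two. The next two constants come from
    the depth 2 * k + 2 with k <= 1 + ln t / ln 2 and ln t = ln B' + m * ln (1 / \<eta>).\<close>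
  define c\<^sub>0 where "c\<^sub>0 = real (4 * m + CARD('p) * (2 * m + 12)) * (2 * B')"
  define c\<^sub>1 where "c\<^sub>1 = 4 + 2 * (ln B' / ln 2)"
  define c\<^sub>2 :: real where "c\<^sub>2 = 2 / ln 2"
  have "\<exists>\<Phi>. relu_network CARD('m) CARD('p) \<Phi> \<and>
        (\<forall>x\<in>K. norm (network_fun \<Phi> x - H x) \<le> \<eta>) \<and>
        real (network_size \<Phi>) \<le> c\<^sub>0 * (1 / \<eta>) ^ CARD('m) \<and>
        real (network_depth \<Phi>) \<le> c\<^sub>1 + c\<^sub>2 * (real CARD('m) * ln (1 / \<eta>))"
    if "0 < \<eta>" "\<eta> < 1" for \<eta>
  proof -
    define \<epsilon> where "\<epsilon> = \<eta> / a"
    have "0 < \<epsilon>" "\<epsilon> \<le> 1" using that \<open>1 \<le> a\<close> by (auto simp: \<epsilon>_def)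
    from B[OF this] obtain F where F: "F \<subseteq> K'" "finite F" "real (card F) \<le> B * (1 / \<epsilon>) ^ m"
      and net: "\<And>x. x \<in> K' \<Longrightarrow> \<exists>y\<in>F. (\<Sum>k\<in>UNIV. \<bar>x $ k - y $ k\<bar>) \<le> \<epsilon>"
      by (auto simp: m_def)
    have "F \<noteq> {}" using net K'(2) by blast
    define t where "t = B' * (1 / \<eta>) ^ m"
    have "1 \<le> (1 / \<eta>) ^ m" using that by (intro one_le_power) auto
    then have "1 \<le> t" using mult_mono[of 1 B' 1 "(1 / \<eta>) ^ m"] \<open>1 \<le> B'\<close> by (simp add: t_def)
    have "B * (1 / \<epsilon>) ^ m \<le> max 1 B * (1 / \<epsilon>) ^ m"
      using \<open>0 < \<epsilon>\<close> by (intro mult_right_mono) auto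
    also have "\<dots> = t" by (simp add: t_def B'_def \<epsilon>_def power_divide)
    finally have "real (card F) \<le> t" using F(3) by linarith
    from ex_power2_between[OF \<open>1 \<le> t\<close>] obtain k :: nat
      where k: "t \<le> 2 ^ k" "2 ^ k \<le> 2 * t" "real k \<le> 1 + ln t / ln 2" .
    have "real (card F) \<le> real (2 ^ k)" using order_trans[OF \<open>real (card F) \<le> t\<close> k(1)] by simp
    then have "card F \<le> 2 ^ k" unfolding of_nat_le_iff .
    have "0 \<le> L'" using \<open>1 \<le> L'\<close> by simp
    from lipschitz_network_from_net[OF this lip' F(1,2) \<open>F \<noteq> {}\<close> \<open>card F \<le> 2 ^ k\<close> net]
    obtain \<Phi> where \<Phi>: "relu_network CARD('m) CARD('p) \<Phi>"
      "\<And>x. x \<in> K' \<Longrightarrow> norm (network_fun \<Phi> x - H x) \<le> real CARD('p) * (2 * L' * \<epsilon>)"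
      "network_size \<Phi> \<le> (4 * CARD('m) + CARD('p) * (2 * CARD('m) + 12)) * 2 ^ k"
      "network_depth \<Phi> = 2 * k + 2"
      by blast
    have "real CARD('p) * (2 * L' * \<epsilon>) = a * \<epsilon>" by (simp add: a_def)
    also have "\<dots> = \<eta>" using \<open>1 \<le> a\<close> by (simp add: \<epsilon>_def)
    finally have "\<forall>x\<in>K. norm (network_fun \<Phi> x - H x) \<le> \<eta>"
      using \<Phi>(2) K'(3) by auto
    moreover have "real (network_size \<Phi>) \<le> c\<^sub>0 * (1 / \<eta>) ^ CARD('m)"
    proof -
      have "real (network_size \<Phi>) \<le> real ((4 * m + CARD('p) * (2 * m + 12)) * 2 ^ k)"
        using \<Phi>(3) unfolding m_def of_nat_le_iff .
      also have "\<dots> = real (4 * m + CARD('p) * (2 * m + 12)) * 2 ^ k" by simp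
      also have "\<dots> \<le> real (4 * m + CARD('p) * (2 * m + 12)) * (2 * t)"
        by (intro mult_left_mono k(2)) simp
      finally show ?thesis by (simp add: c\<^sub>0_def t_def m_def mult.assoc)
    qed
    moreover have "real (network_depth \<Phi>) \<le> c\<^sub>1 + c\<^sub>2 * (real CARD('m) * ln (1 / \<eta>))"
    proof -
      have "ln t = ln B' + real m * ln (1 / \<eta>)"
        using \<open>1 \<le> B'\<close> that by (simp add: t_def ln_mult ln_realpow)
      then have "real k \<le> 1 + (ln B' + real m * ln (1 / \<eta>)) / ln 2"
        using k(3) by (simp only:)
      then have "2 * real k + 2 \<le> 4 + 2 * ((ln B' + real m * ln (1 / \<eta>)) / ln 2)"
        by linarith
      also have "\<dots> = c\<^sub>1 + c\<^sub>2 * (real m * ln (1 / \<eta>))"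
        by (simp add: c\<^sub>1_def c\<^sub>2_def add_divide_distrib)
      finally show ?thesis by (simp add: \<Phi>(4) m_def)
    qed
    ultimately show ?thesis using \<Phi>(1) by blast
  qed
  moreover have "c\<^sub>0 > 0"
    unfolding c\<^sub>0_def using \<open>1 \<le> B'\<close> by (intro mult_pos_pos) (auto simp: m_def simp del: of_nat_add of_nat_mult)
  moreover have "c\<^sub>1 > 0" using \<open>1 \<le> B'\<close> by (simp add: c\<^sub>1_def add_pos_nonneg)
  moreover have "c\<^sub>2 > 0" by (simp add: c\<^sub>2_def)
  ultimately show ?thesis by blast
qed

section \<open>From uniform to L2 bounds, and the rate in terms of network size\<close>

lemma L2_enorm_le_uniform:
  fixes f :: "'a \<Rightarrow> 'b::real_normed_vector"
  assumes "f \<in> borel_measurable M" "emeasure M (space M) \<le> 1" "0 \<le> \<eta>"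
    and "\<And>x. x \<in> space M \<Longrightarrow> norm (f x) \<le> \<eta>"
  shows "L2_enorm M f \<le> ennreal \<eta>"
proof -
  have "(\<integral>\<^sup>+ x. ennreal ((norm (f x))\<^sup>2) \<partial>M) \<le> (\<integral>\<^sup>+ x. ennreal (\<eta>\<^sup>2) \<partial>M)"
    using assms by (intro nn_integral_mono ennreal_leI power_mono) auto
  also have "\<dots> \<le> ennreal (\<eta>\<^sup>2) * 1"
    using assms(2) unfolding nn_integral_const by (rule mult_left_mono) simp
  finally have le: "(\<integral>\<^sup>+ x. ennreal ((norm (f x))\<^sup>2) \<partial>M) \<le> ennreal (\<eta>\<^sup>2)" by simp
  then have "enn2real (\<integral>\<^sup>+ x. ennreal ((norm (f x))\<^sup>2) \<partial>M) \<le> \<eta>\<^sup>2"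
    by (simp add: enn2real_leI)
  then have "sqrt (enn2real (\<integral>\<^sup>+ x. ennreal ((norm (f x))\<^sup>2) \<partial>M)) \<le> \<eta>"
    using \<open>0 \<le> \<eta>\<close> by (simp add: real_le_lsqrt)
  \<comment> \<open>Finiteness and measurability select the finite branch of
    \<open>L2_enorm\<close>.\<close>
  moreover have "(\<integral>\<^sup>+ x. ennreal ((norm (f x))\<^sup>2) \<partial>M) < \<infinity>"
    using le by (simp add: le_less_trans)
  ultimately show ?thesis
    using assms(1) by (simp add: L2_enorm_def ennreal_leI)
qed

text \<open>The accuracy \<open>\<eta> = max 1 (2 * c) * (p * ln N / N) powr (1 / m)\<close> turns the size bound into \<open>N\<close>,
  because \<open>ln (1 / \<eta>) \<le> ln N\<close>.\<close>

lemma network_error_rate: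
  fixes H :: "real ^ 'm::finite \<Rightarrow> real ^ 'p::finite"
  assumes "0 < c" "1 \<le> p"
    and approx: "\<And>\<eta>. 0 < \<eta> \<Longrightarrow> \<eta> < 1 \<Longrightarrow> \<exists>\<Phi>. relu_network CARD('m) CARD('p) \<Phi> \<and>
        L2_enorm \<nu> (\<lambda>x. network_fun \<Phi> x - H x) \<le> ennreal \<eta> \<and>
        real (network_size \<Phi>) \<le> c * p * \<eta> powr (- real CARD('m)) * (1 + ln (1 / \<eta>))"
  shows "\<forall>\<^sub>F N in sequentially.
    network_error \<nu> H N \<le> ennreal (max 1 (2 * c) * (p * ln (real N) / real N) powr (1 / real CARD('m)))"
proof -
  define m where "m = real CARD('m)"
  define A where "A = max 1 (2 * c)"
  define t where "t = (\<lambda>N :: nat. p * ln (real N) / real N)"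
  define \<eta> where "\<eta> = (\<lambda>N. A * t N powr (1 / m))"
  have "1 \<le> m" by (simp add: m_def Suc_leI)
  \<comment> \<open>The first bound gives ln A >= 0 and A <= A powr m; the second then absorbs
    \<open>c\<close> together with the 2 in 1 + ln (1 / \<eta>) <= 2 * ln N.\<close>
  have "1 \<le> A" "2 * c \<le> A" by (auto simp: A_def)
  have "(\<lambda>N. ln (real N) / real N) \<longlonglongrightarrow> 0" by (rule lim_ln_over_n)
  then have "t \<longlonglongrightarrow> 0"
    unfolding t_def times_divide_eq_right [symmetric] by (rule tendsto_mult_right_zero)
  \<comment> \<open>From here on ln N absorbs the summand 1 of the logarithmic factor; 3 exceeds
    Euler's number.\<close>
  have ln3: "1 \<le> ln (real N)" if "3 \<le> N" for N
  proof -
    have "exp 1 \<le> real N" using exp_le that by linarith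
    then show ?thesis using that by (subst ln_ge_iff) auto
  qed
  have "(\<lambda>N. \<eta> N) \<longlonglongrightarrow> A * 0"
    unfolding \<eta>_def
  proof (intro tendsto_mult tendsto_const)
    have "\<forall>\<^sub>F N in sequentially. 0 \<le> t N"
      using eventually_ge_at_top[of 1] by eventually_elim (use \<open>1 \<le> p\<close> in \<open>simp add: t_def\<close>)
    then show "(\<lambda>N. t N powr (1 / m)) \<longlonglongrightarrow> 0"
      using tendsto_powr'[OF \<open>t \<longlonglongrightarrow> 0\<close> tendsto_const, of "1 / m"] \<open>1 \<le> m\<close> by simp
  qed
  then have "\<forall>\<^sub>F N in sequentially. \<eta> N < 1"
    by (intro order_tendstoD) auto
  then show ?thesis
    using eventually_ge_at_top[of 3]
  proof eventually_elim
    case (elim N)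
    have "1 \<le> ln (real N)" "0 < real N" using ln3 elim by auto
    then have "1 \<le> p * ln (real N)" using mult_mono[of 1 p 1 "ln (real N)"] \<open>1 \<le> p\<close> by simp
    then have "0 < t N" using \<open>0 < real N\<close> unfolding t_def by (intro divide_pos_pos) auto
    then have "0 < \<eta> N" using \<open>1 \<le> A\<close> by (simp add: \<eta>_def)
    have "ln (1 / \<eta> N) = - ln A + (1 / m) * (- ln (t N))"
      using \<open>0 < t N\<close> \<open>1 \<le> A\<close> by (simp add: \<eta>_def ln_div ln_mult ln_powr)
    also have "- ln (t N) = ln (real N) - ln (p * ln (real N))"
      using \<open>1 \<le> p * ln (real N)\<close> \<open>0 < real N\<close> unfolding t_def by (subst ln_div) auto
    also have "(1 / m) * (ln (real N) - ln (p * ln (real N))) \<le> 1 * ln (real N)"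
    proof (rule order_trans)
      show "(1 / m) * (ln (real N) - ln (p * ln (real N))) \<le> (1 / m) * ln (real N)"
        using \<open>1 \<le> m\<close> \<open>1 \<le> p * ln (real N)\<close> by (intro mult_left_mono) auto
      show "(1 / m) * ln (real N) \<le> 1 * ln (real N)"
        using \<open>1 \<le> m\<close> \<open>1 \<le> ln (real N)\<close> by (intro mult_right_mono) auto
    qed
    finally have "ln (1 / \<eta> N) \<le> ln (real N)"
      using ln_ge_zero[OF \<open>1 \<le> A\<close>] by linarith
    then have log: "1 + ln (1 / \<eta> N) \<le> 2 * ln (real N)"
      using \<open>1 \<le> ln (real N)\<close> by linarith
    have "A powr 1 \<le> A powr m" using \<open>1 \<le> A\<close> \<open>1 \<le> m\<close> by (intro powr_mono) auto
    then have "2 * c \<le> A powr m" using \<open>1 \<le> A\<close> \<open>2 * c \<le> A\<close> by simp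
    have "\<eta> N powr m = A powr m * t N"
      using \<open>0 < t N\<close> \<open>1 \<le> A\<close> \<open>1 \<le> m\<close> by (simp add: \<eta>_def powr_mult powr_powr)
    then have pw: "\<eta> N powr (- m) = 1 / (A powr m * t N)"
      by (simp add: powr_minus divide_inverse)
    from approx[OF \<open>0 < \<eta> N\<close> \<open>\<eta> N < 1\<close>] obtain \<Phi> where \<Phi>: "relu_network CARD('m) CARD('p) \<Phi>"
      "L2_enorm \<nu> (\<lambda>x. network_fun \<Phi> x - H x) \<le> ennreal (\<eta> N)"
      "real (network_size \<Phi>) \<le> c * p * \<eta> N powr (- m) * (1 + ln (1 / \<eta> N))"
      by (auto simp: m_def)
    have "real (network_size \<Phi>) \<le> c * p * \<eta> N powr (- m) * (2 * ln (real N))"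
      using \<open>0 < c\<close> \<open>1 \<le> p\<close> by (intro order_trans[OF \<Phi>(3)] mult_left_mono log) auto
    \<comment> \<open>The numerator of \<open>t N\<close> cancels \<open>p\<close> and the
      logarithm, and its denominator leaves \<open>N\<close>.\<close>
    also have "\<dots> = (2 * c / A powr m) * real N"
    proof -
      have "ln (real N) \<noteq> 0" "p \<noteq> 0" using \<open>1 \<le> ln (real N)\<close> \<open>1 \<le> p\<close> by auto
      then show ?thesis by (simp add: pw t_def)
    qed
    also have "\<dots> \<le> 1 * real N"
      using \<open>2 * c \<le> A powr m\<close> \<open>1 \<le> A\<close> by (intro mult_right_mono) auto
    finally have "network_size \<Phi> \<le> N" by simp
    then have "network_error \<nu> H N \<le> ennreal (\<eta> N)"
      unfolding network_error_def using \<Phi>(1,2) by (intro INF_lower2[of \<Phi>]) auto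
    then show ?case by (simp add: \<eta>_def A_def t_def m_def)
  qed
qed

theorem theorem2p3:
  fixes D\<^sub>G D\<^sub>L :: "'x::{real_inner, polish_space} set"
    and G :: "'x \<Rightarrow> 'y::{real_inner, polish_space}"
    and W :: "'y set"
    and C\<^sub>L :: real
    and \<mu> :: "'x measure"
    and \<E> :: "'x \<Rightarrow> real ^ 'm::finite"
    and \<D> :: "real ^ 'm \<Rightarrow> 'x"
    and \<P> :: "'y \<Rightarrow> real ^ 'p::finite"
    and K :: "(real ^ 'm) set"
    and H :: "real ^ 'm \<Rightarrow> real ^ 'p"
    and \<nu> :: "(real ^ 'm) measure"
  assumes "closed D\<^sub>G" and "continuous_on D\<^sub>G G"
    and "finite_dimensional_class W" and "D\<^sub>L = data_generated_by D\<^sub>G G W"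
    and "\<And>f\<^sub>1 f\<^sub>2. f\<^sub>1 \<in> D\<^sub>L \<Longrightarrow> f\<^sub>2 \<in> D\<^sub>L \<Longrightarrow> norm (G f\<^sub>1 - G f\<^sub>2) \<le> C\<^sub>L * norm (f\<^sub>1 - f\<^sub>2)"
    and "prob_space \<mu>" and "sets \<mu> = sets borel" and "emeasure \<mu> D\<^sub>G = 1"
    and "(\<integral>\<^sup>+ f. ennreal ((norm f)\<^sup>2) \<partial>\<mu>) < \<infinity>"
    and "(\<integral>\<^sup>+ f\<in>D\<^sub>G. ennreal ((norm (G f))\<^sup>2) \<partial>\<mu>) < \<infinity>"
    and "\<E> \<in> borel_measurable borel"
    and "\<exists>L. L-lipschitz_on UNIV \<D>" and "\<exists>L. L-lipschitz_on UNIV \<P>"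
    and "K = measure_support (distr \<mu> borel \<E>)"
    and "compact K" and "\<D> ` K \<subseteq> D\<^sub>L"
    and "\<And>x. x \<in> K \<Longrightarrow> H x = \<P> (G (\<D> x))"
    and "\<nu> = restrict_space (distr \<mu> borel \<E>) K"
  shows "\<exists>c\<^sub>0 c\<^sub>1 c\<^sub>2 C :: real. c\<^sub>0 > 0 \<and> c\<^sub>1 > 0 \<and> c\<^sub>2 > 0 \<and> C > 0 \<and>
    (\<forall>\<eta>. 0 < \<eta> \<and> \<eta> < 1 \<longrightarrow>
      (\<exists>\<Phi>. relu_network CARD('m) CARD('p) \<Phi> \<and>
        L2_enorm \<nu> (\<lambda>x. network_fun \<Phi> x - H x) \<le> ennreal \<eta> \<and>
        real (network_size \<Phi>) \<le>
          c\<^sub>0 * (real CARD('p) + 1) * \<eta> powr (- real CARD('m)) * (1 + ln (1 / \<eta>)) \<and>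
        real (network_depth \<Phi>) \<le> c\<^sub>1 + c\<^sub>2 * real CARD('m) * ln (1 / \<eta>))) \<and>
    (\<forall>\<^sub>F N in sequentially.
      network_error \<nu> H N \<le>
        ennreal (C * ((real CARD('p) + 1) * ln (real N) / real N) powr (1 / real CARD('m))))"
proof -
  obtain L\<^sub>D where LD: "L\<^sub>D-lipschitz_on UNIV \<D>" using assms(12) by blast
  obtain L\<^sub>P where LP: "L\<^sub>P-lipschitz_on UNIV \<P>" using assms(13) by blast
  have "0 \<le> L\<^sub>P" using LP by (rule lipschitz_on_nonneg)
  \<comment> \<open>No sign of \<open>C\<^sub>L\<close> is assumed; its absolute value keeps the
    chain of estimates monotone.\<close>
  define L where "L = L\<^sub>P * (\<bar>C\<^sub>L\<bar> * L\<^sub>D)"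
  have lip: "norm (H x - H y) \<le> L * norm (x - y)" if "x \<in> K" "y \<in> K" for x y
  proof -
    have D: "\<D> x \<in> D\<^sub>L" "\<D> y \<in> D\<^sub>L" using that assms(16) by auto
    have "norm (H x - H y) \<le> L\<^sub>P * norm (G (\<D> x) - G (\<D> y))"
      using lipschitz_onD[OF LP] that by (simp add: assms(17) dist_norm)
    also have "\<dots> \<le> L\<^sub>P * (C\<^sub>L * norm (\<D> x - \<D> y))"
      using assms(5)[OF D] \<open>0 \<le> L\<^sub>P\<close> by (rule mult_left_mono)
    also have "\<dots> \<le> L\<^sub>P * (\<bar>C\<^sub>L\<bar> * norm (\<D> x - \<D> y))"
      using \<open>0 \<le> L\<^sub>P\<close> by (intro mult_left_mono mult_right_mono) auto
    also have "\<dots> \<le> L\<^sub>P * (\<bar>C\<^sub>L\<bar> * (L\<^sub>D * norm (x - y)))"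
      using lipschitz_onD[OF LD, of x y] \<open>0 \<le> L\<^sub>P\<close> by (intro mult_left_mono) (auto simp: dist_norm)
    finally show ?thesis by (simp add: L_def mult_ac)
  qed
  have K: "K \<in> sets borel" using assms(15) by (intro borel_closed compact_imp_closed)
  have space: "space \<nu> = K" by (simp add: assms(18) space_restrict_space)
  have sets: "sets \<nu> = sets (restrict_space borel K)"
    unfolding assms(18) by (intro sets_restrict_space_cong) simp
  have mass: "emeasure \<nu> (space \<nu>) \<le> 1"
  proof -
    interpret prob_space \<mu> by (rule assms(6))
    have "\<E> \<in> measurable \<mu> borel"
      using assms(11) measurable_cong_sets[OF assms(7) refl] by blast
    then interpret E: prob_space "distr \<mu> borel \<E>" by (rule prob_space_distr)
    have "emeasure \<nu> K = emeasure (distr \<mu> borel \<E>) K"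
      unfolding assms(18) using K by (intro emeasure_restrict_space) auto
    then show ?thesis unfolding space using E.emeasure_le_1 by simp
  qed
  \<comment> \<open>Continuity makes the error measurable, without which \<open>L2_enorm\<close>
    would be infinite. \<open>lipschitz_on\<close> demands a nonnegative constant, hence
    |L|.\<close>
  have "continuous_on K H"
    using lip by (intro lipschitz_on_continuous_on[of "\<bar>L\<bar>"] lipschitz_onI)
      (auto simp: dist_norm intro!: order_trans[OF lip] mult_right_mono)
  then have meas: "(\<lambda>x. network_fun \<Phi> x - H x) \<in> borel_measurable \<nu>" for \<Phi>
    unfolding measurable_cong_sets[OF sets refl]
    by (intro borel_measurable_continuous_on_restrict continuous_on_diff continuous_on_network_fun)
  have "bounded K" using assms(15) by (rule compact_imp_bounded)
  from lipschitz_network_approximation[OF this lip] obtain c\<^sub>0 c\<^sub>1 c\<^sub>2 :: real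
    where c: "c\<^sub>0 > 0" "c\<^sub>1 > 0" "c\<^sub>2 > 0"
      and approx: "\<And>\<eta>. 0 < \<eta> \<Longrightarrow> \<eta> < 1 \<Longrightarrow> \<exists>\<Phi>. relu_network CARD('m) CARD('p) \<Phi> \<and>
        (\<forall>x\<in>K. norm (network_fun \<Phi> x - H x) \<le> \<eta>) \<and>
        real (network_size \<Phi>) \<le> c\<^sub>0 * (1 / \<eta>) ^ CARD('m) \<and>
        real (network_depth \<Phi>) \<le> c\<^sub>1 + c\<^sub>2 * (real CARD('m) * ln (1 / \<eta>))"
    by blast
  have part1: "\<exists>\<Phi>. relu_network CARD('m) CARD('p) \<Phi> \<and>
        L2_enorm \<nu> (\<lambda>x. network_fun \<Phi> x - H x) \<le> ennreal \<eta> \<and>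
        real (network_size \<Phi>) \<le>
          c\<^sub>0 * (real CARD('p) + 1) * \<eta> powr (- real CARD('m)) * (1 + ln (1 / \<eta>)) \<and>
        real (network_depth \<Phi>) \<le> c\<^sub>1 + c\<^sub>2 * real CARD('m) * ln (1 / \<eta>)"
    if \<eta>: "0 < \<eta>" "\<eta> < 1" for \<eta>
  proof -
    from approx[OF \<eta>] obtain \<Phi> where \<Phi>: "relu_network CARD('m) CARD('p) \<Phi>"
      "\<And>x. x \<in> K \<Longrightarrow> norm (network_fun \<Phi> x - H x) \<le> \<eta>"
      "real (network_size \<Phi>) \<le> c\<^sub>0 * (1 / \<eta>) ^ CARD('m)"
      "real (network_depth \<Phi>) \<le> c\<^sub>1 + c\<^sub>2 * (real CARD('m) * ln (1 / \<eta>))" by blast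
    have "L2_enorm \<nu> (\<lambda>x. network_fun \<Phi> x - H x) \<le> ennreal \<eta>"
      using \<eta> \<Phi>(2) by (intro L2_enorm_le_uniform meas mass) (auto simp: space)
    moreover have "c\<^sub>0 * (1 / \<eta>) ^ CARD('m) \<le>
        c\<^sub>0 * (real CARD('p) + 1) * \<eta> powr (- real CARD('m)) * (1 + ln (1 / \<eta>))"
    proof -
      have "(1 / \<eta>) ^ CARD('m) = \<eta> powr (- real CARD('m))"
        using \<eta> by (simp add: powr_minus powr_realpow power_inverse divide_inverse)
      moreover have "0 \<le> ln (1 / \<eta>)" using \<eta> by (intro ln_ge_zero) simp
      \<comment> \<open>The factors \<open>real CARD('p) + 1\<close> and 1 + ln (1 / \<eta>) are
        both at least 1.\<close>
      moreover have "c\<^sub>0 * \<eta> powr (- real CARD('m)) * (1 * 1) \<le>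
          c\<^sub>0 * \<eta> powr (- real CARD('m)) * ((real CARD('p) + 1) * (1 + ln (1 / \<eta>)))"
        using c \<open>0 \<le> ln (1 / \<eta>)\<close> by (intro mult_left_mono mult_mono) auto
      ultimately show ?thesis by (simp add: mult_ac)
    qed
    ultimately show ?thesis using \<Phi> by (intro exI[of _ \<Phi>]) (simp add: mult.assoc)
  qed
  \<comment> \<open>The constant of \<open>network_error_rate\<close>, whose real parameter
    \<open>p\<close> is instantiated by \<open>real CARD('p) + 1\<close>.\<close>
  define C where "C = max 1 (2 * c\<^sub>0)"
  have "\<forall>\<^sub>F N in sequentially. network_error \<nu> H N \<le>
      ennreal (C * ((real CARD('p) + 1) * ln (real N) / real N) powr (1 / real CARD('m)))"
    unfolding C_def using part1 by (intro network_error_rate c) (simp, blast)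
  moreover have "C > 0" by (simp add: C_def)
  ultimately show ?thesis using c part1 by blast
qed

end
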